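(* Assume the setting and conditions (K1)--(K4) of the context. Let $T>0$, $\tau>0$, and suppose that $u_n\in Y$ solves, for $0\le n\tau\le T$, the linearly implicit midpoint rule $$\frac{u_{n+1}-u_n}{\tau}+A(\widehat u_{n+1/2})\frac{u_{n+1}+u_n}{2}=f(\widehat u_{n+1/2}),\qquad \widehat u_{n+1/2}=u_n+\tfrac12(u_n-u_{n-1}),$$ (with $\widehat u_{1/2}=u_0$), and that $u_n^\star\in Y$ solves it up to a defect $d_{n+1/2}\in Y$, for $0\le n\tau\le T$: $$\frac{u^\star_{n+1}-u^\star_n}{\tau}+A(\widehat u^\star_{n+1/2})\frac{u^\star_{n+1}+u^\star_n}{2}=f(\widehat u^\star_{n+1/2})+d_{n+1/2},\qquad \widehat u^\star_{n+1/2}=u^\star_n+\tfrac12(u^\star_n-u^\star_{n-1}),$$ (with $\widehat u^\star_{1/2}=u^\star_0$). Suppose that, for $0\le n\tau\le T$, $$\|u_n^\star\|\le R\quad\text{and}\quad Su_n^\star\in Y\ \text{ with }\ \|Su_n^\star\|\le K.$$ Then there exist $\overline\tau>0$ and $\delta>0$, which depend only on $K$, $R$ and $T$, such that for stepsizes $\tau\le\overline\tau$ and perturbations satisfying $$\|u_0-u_0^\star\|^2+\tau\sum_{0\le n\tau\le T}\|d_{n+1/2}\|^2\le\delta^2,$$ the error satisfies, for $0\le n\tau\le T$, $$\|u_n-u_n^\star\|^2\le C_Y\Bigl(\|u_0-u_0^\star\|^2+\tau\sum_{k=0}^{n-1}\|d_{k+1/2}\|^2\Bigr),$$ $$|u_n-u_n^\star|^2\le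 C_X\Bigl(|u_0-u_0^\star|^2+\tau\sum_{k=0}^{n-1}|d_{k+1/2}|^2\Bigr),$$ where $C_Y$ depends only on $K$, $R$ and $T$, and $C_X$ depends only on $R$ and $T$.
   Context: Let $X$ and $Y$ be real Hilbert spaces such that $Y$ is densely and continuously embedded in $X$. The inner product on $X$ is $(\cdot,\cdot)$, the norms are $|\cdot|=\|\cdot\|_X$ and $\|\cdot\|=\|\cdot\|_Y$, chosen such that $|y|\le\|y\|$ for all $y\in Y$. For every $y\in Y$, $A(y)$ is a closed linear operator on $X$ with domain $D(A(y))$, and $f:X\to X$. For every $R>0$ the following conditions hold, with real numbers $M_R^A,M_R^B,L_R^A,L_R^B,\ell_R^X,\ell_R^Y$ depending only on $R$. (K1) For every $y\in Y$, $A(y)$ has the open left complex half-plane in its resolvent set (in the sense of the complexification) and satisfies $(w,A(y)w)\ge0$ for all $w\in D(A(y))$. Moreover $Y\subset D(A(y))$, and for $\|y\|\le R$, $|A(y)w|\le M_R^A\|w\|$ for all $w\in Y$. (K2) There is an isometry $S:Y\to X$, self-adjoint as a linear operator on $X$ (with domain $Y$), such that for every $y\in Y$ with $\|y\|\le R$, $SA(y)S^{-1}=A(y)+B(y)$ (with equality of domains), where $|B(y)v|\le M_R^B|v|$ for all $v\in X$. (K3) For all $y,\widetilde y\in Y$ with $\|y\|\le R$, $\|\widetilde y\|\le R$: $|(A(y)-A(\widetilde y))w|\le L_R^A|y-\widetilde y|\,\|w\|$ for all $w\in Y$, and $|(B(y)-B(\widetilde y))v|\le L_R^B\|y-\widetilde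 y\|\,|v|$ for all $v\in X$. (K4) $f$ maps $Y$ into $Y$, and for all $y,\widetilde y\in Y$ with $\|y\|\le R$, $\|\widetilde y\|\le R$: $|f(y)-f(\widetilde y)|\le\ell_R^X|y-\widetilde y|$ and $\|f(y)-f(\widetilde y)\|\le\ell_R^Y\|y-\widetilde y\|$. The data $X,Y,A,f,S$ are fixed; constants said to depend only on $R$ (or $K,R,T$) may depend on the constants in (K1)--(K4), but not on $\tau$, $n$, or the sequences considered. *)

theory Defs
  imports "HOL-Analysis.Analysis"
begin

text \<open>
  An unbounded operator on a real Hilbert space is given by its domain \<open>D\<close> together with a
  total function; the values of the function outside \<open>D\<close> are irrelevant.
\<close>

definition closed_linear_operator :: "'x::real_normed_vector set \<Rightarrow> ('x \<Rightarrow> 'x) \<Rightarrow> bool" where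
  "closed_linear_operator D A \<longleftrightarrow>
     subspace D \<and>
     (\<forall>v\<in>D. \<forall>w\<in>D. A (v + w) = A v + A w) \<and>
     (\<forall>c. \<forall>v\<in>D. A (c *\<^sub>R v) = c *\<^sub>R A v) \<and>
     closed {(v, A v) | v. v \<in> D}"

text \<open>
  The adjoint of a densely defined operator \<open>(D, A)\<close> relates \<open>x\<close> to \<open>z\<close> iff
  \<open>(A y, x) = (y, z)\<close> for all \<open>y \<in> D\<close>; self-adjointness says that this relation is the
  graph of \<open>(D, A)\<close>, so in particular the domains agree.
\<close>

definition self_adjoint_operator :: "'x::real_inner set \<Rightarrow> ('x \<Rightarrow> 'x) \<Rightarrow> bool" where
  "self_adjoint_operator D A \<longleftrightarrow>
     subspace D \<and> closure D = UNIV \<and>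
     (\<forall>v\<in>D. \<forall>w\<in>D. A (v + w) = A v + A w) \<and>
     (\<forall>c. \<forall>v\<in>D. A (c *\<^sub>R v) = c *\<^sub>R A v) \<and>
     (\<forall>x z. (\<forall>y\<in>D. inner (A y) x = inner y z) \<longleftrightarrow> (x \<in> D \<and> z = A x))"

text \<open>
  The complexification of \<open>X\<close> is \<open>X \<times> X\<close>, where \<open>(v, w)\<close> stands for \<open>v + i w\<close>. The product
  norm of the library, with square \<open>|v|\<^sup>2 + |w|\<^sup>2\<close>, is the Hilbert norm of the complexification.
\<close>

definition complex_scale :: "complex \<Rightarrow> 'x::real_vector \<times> 'x \<Rightarrow> 'x \<times> 'x" where
  "complex_scale l z =
     (Re l *\<^sub>R fst z - Im l *\<^sub>R snd z, Re l *\<^sub>R snd z + Im l *\<^sub>R fst z)"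

definition resolvent_set :: "'x::real_normed_vector set \<Rightarrow> ('x \<Rightarrow> 'x) \<Rightarrow> complex set" where
  "resolvent_set D A =
     {l. bij_betw (\<lambda>z. complex_scale l z - map_prod A A z) (D \<times> D) UNIV \<and>
         bounded_linear (inv_into (D \<times> D) (\<lambda>z. complex_scale l z - map_prod A A z))}"

text \<open>
  \<open>Y\<close> is a Hilbert space of its own, embedded in \<open>X\<close> by \<open>emb\<close>; as a subset of \<open>X\<close> it is
  \<open>range emb\<close>. The argument of \<open>MA\<close>, \<dots>, \<open>lY\<close> is the radius \<open>R\<close>. The perturbation \<open>B y\<close> is
  a linear operator defined on all of \<open>X\<close>; it does not depend on \<open>R\<close>, since the commutator
  identity determines it on the dense set \<open>D y\<close>.
\<close>

locale kato_setting =
  fixes emb :: "'y::{real_inner, complete_space} \<Rightarrow> 'x::{real_inner, complete_space}"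
    and D :: "'y \<Rightarrow> 'x set"
    and A :: "'y \<Rightarrow> 'x \<Rightarrow> 'x"
    and B :: "'y \<Rightarrow> 'x \<Rightarrow> 'x"
    and S :: "'y \<Rightarrow> 'x"
    and f :: "'x \<Rightarrow> 'x"
    and MA MB LA LB lX lY :: "real \<Rightarrow> real"
  assumes emb_bounded_linear: "bounded_linear emb"
    and emb_inj: "inj emb"
    and emb_dense: "closure (range emb) = UNIV"
    and emb_norm_le: "\<And>y. norm (emb y) \<le> norm y"
    and A_closed: "\<And>y. closed_linear_operator (D y) (A y)"
    and A_resolvent: "\<And>y. {l. Re l < 0} \<subseteq> resolvent_set (D y) (A y)"
    and A_accretive: "\<And>y w. w \<in> D y \<Longrightarrow> 0 \<le> inner w (A y w)"
    and range_emb_subset_D: "\<And>y. range emb \<subseteq> D y"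
    and A_bound: "\<And>R y w. 0 < R \<Longrightarrow> norm y \<le> R \<Longrightarrow> norm (A y (emb w)) \<le> MA R * norm w"
    and S_linear: "linear S"
    and S_isometry: "\<And>y. norm (S y) = norm y"
    and S_self_adjoint: "self_adjoint_operator (range emb) (\<lambda>x. S (inv emb x))"
    and commutator_domain:
      "\<And>y. {v \<in> range S. emb (inv S v) \<in> D y \<and> A y (emb (inv S v)) \<in> range emb} = D y"
    and commutator:
      "\<And>y v. v \<in> D y \<Longrightarrow> S (inv emb (A y (emb (inv S v)))) = A y v + B y v"
    and B_linear: "\<And>y. linear (B y)"
    and B_bound: "\<And>R y v. 0 < R \<Longrightarrow> norm y \<le> R \<Longrightarrow> norm (B y v) \<le> MB R * norm v"
    and A_Lipschitz: "\<And>R y y' w. 0 < R \<Longrightarrow> norm y \<le> R \<Longrightarrow> norm y' \<le> R \<Longrightarrow>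
      norm (A y (emb w) - A y' (emb w)) \<le> LA R * norm (emb (y - y')) * norm w"
    and B_Lipschitz: "\<And>R y y' v. 0 < R \<Longrightarrow> norm y \<le> R \<Longrightarrow> norm y' \<le> R \<Longrightarrow>
      norm (B y v - B y' v) \<le> LB R * norm (y - y') * norm v"
    and f_maps_Y: "\<And>y. f (emb y) \<in> range emb"
    and f_Lipschitz_X: "\<And>R y y'. 0 < R \<Longrightarrow> norm y \<le> R \<Longrightarrow> norm y' \<le> R \<Longrightarrow>
      norm (f (emb y) - f (emb y')) \<le> lX R * norm (emb (y - y'))"
    and f_Lipschitz_Y: "\<And>R y y'. 0 < R \<Longrightarrow> norm y \<le> R \<Longrightarrow> norm y' \<le> R \<Longrightarrow>
      norm (inv emb (f (emb y) - f (emb y'))) \<le> lY R * norm (y - y')"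

definition midpoint_extrapolation :: "(nat \<Rightarrow> 'y::real_vector) \<Rightarrow> nat \<Rightarrow> 'y" where
  "midpoint_extrapolation u n =
     (if n = 0 then u 0 else u n + (1 / 2) *\<^sub>R (u n - u (n - 1)))"

text \<open>
  \<open>d n\<close> is the defect at the half step \<open>n + 1/2\<close>. The equations hold in \<open>X\<close>, for all \<open>n\<close>
  with \<open>n \<tau> \<le> T\<close>; the last of them also involves \<open>u (n + 1)\<close> at a time beyond \<open>T\<close>.
\<close>

definition implicit_midpoint_solution ::
  "('y::real_vector \<Rightarrow> 'x::real_vector) \<Rightarrow> ('y \<Rightarrow> 'x \<Rightarrow> 'x) \<Rightarrow> ('x \<Rightarrow> 'x) \<Rightarrow>
    real \<Rightarrow> real \<Rightarrow> (nat \<Rightarrow> 'y) \<Rightarrow> (nat \<Rightarrow> 'y) \<Rightarrow> bool" where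
  "implicit_midpoint_solution emb A f \<tau> T u d \<longleftrightarrow>
     (\<forall>n. real n * \<tau> \<le> T \<longrightarrow>
        (1 / \<tau>) *\<^sub>R (emb (u (n + 1)) - emb (u n))
          + A (midpoint_extrapolation u n) ((1 / 2) *\<^sub>R (emb (u (n + 1)) + emb (u n)))
        = f (emb (midpoint_extrapolation u n)) + emb (d n))"

end

theory Submission
  imports Defs
begin

text \<open>
  Let \<open>e n = u n - u' n\<close>. Subtracting the two schemes gives a linear midpoint step for \<open>e\<close> with the
  operator \<open>A\<close> frozen at the extrapolated value of \<open>u\<close>, and a right-hand side made of the differences
  of \<open>A\<close> and \<open>f\<close> at the two extrapolated values, and of the defect. The operator is accretive,
  so testing with the midpoint of \<open>e\<close> shows that one step increases \<open>norm (emb (e n))\<close> by at most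
  \<open>\<tau>\<close> times the norm of the right-hand side (\<open>accretive_midpoint_step\<close>). The difference of
  the operators acts on the midpoint of \<open>u'\<close>, which is bounded in \<open>Y\<close>, so that this right-hand
  side is controlled by the error in \<open>X\<close> (\<open>error_step_X\<close>).

  Applying \<open>S\<close> to the error equation gives the same structure for \<open>S (e n)\<close>: by the
  commutator identity \<open>S\<close> passes through \<open>A\<close> at the cost of the bounded operator \<open>B\<close>. Now the
  difference of the operators acts on the midpoint of \<open>S u'\<close>, and this is where \<open>S u' \<in> Y\<close>
  with norm at most \<open>K\<close> enters (\<open>error_step_Y\<close>). The isometry \<open>norm (S y) = norm y\<close> turns the result
  into an estimate in the norm of \<open>Y\<close>; the implicit term from \<open>B\<close> is absorbed for small \<open>\<tau>\<close>.

  Both recursions are closed by a discrete Gronwall inequality. The constants are those of one fixed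
  ball, of radius \<open>4 R\<close>, which contains the extrapolated values as long as
  \<open>norm (e k) \<le> R\<close> for all \<open>k\<close> up to the current step. This is maintained by induction, since
  the estimate in \<open>Y\<close> yields \<open>norm (e n) \<le> R\<close> again once \<open>\<delta>\<close> is small. Neither this radius nor
  \<open>error_step_X\<close> involves \<open>K\<close>, so the constant of the estimate in \<open>X\<close> is independent of \<open>K\<close>.
\<close>

section \<open>Energy inequality, Gronwall inequality, extrapolation\<close>

text \<open>
  Pairing the equation with \<open>g1 + g0\<close> bounds \<open>(norm g1)\<^sup>2 - (norm g0)\<^sup>2\<close>, and the common factor
  \<open>norm g1 + norm g0\<close> cancels. Hence the bound is linear in the norms and holds for every step size.
\<close>

lemma accretive_midpoint_step:
  fixes g0 g1 a r :: "'a::real_inner"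
  assumes "0 < \<tau>"
    and step: "(1 / \<tau>) *\<^sub>R (g1 - g0) + a = r"
    and accretive: "0 \<le> inner ((1 / 2) *\<^sub>R (g1 + g0)) a"
  shows "norm g1 \<le> norm g0 + \<tau> * norm r"
proof (cases "norm g1 + norm g0 = 0")
  case True
  then show ?thesis
    using assms(1) norm_ge_zero[of g1] norm_ge_zero[of g0] by (smt (verit) mult_nonneg_nonneg norm_ge_zero)
next
  case False
  then have pos: "0 < norm g1 + norm g0"
    by (smt (verit) norm_ge_zero)
  have "g1 - g0 = \<tau> *\<^sub>R ((1 / \<tau>) *\<^sub>R (g1 - g0))"
    using assms(1) by simp
  also have "(1 / \<tau>) *\<^sub>R (g1 - g0) = r - a"
    using step by (metis add_diff_cancel_right')
  finally have diff: "g1 - g0 = \<tau> *\<^sub>R (r - a)" .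
  have "(norm g1 + norm g0) * (norm g1 - norm g0) = (norm g1)\<^sup>2 - (norm g0)\<^sup>2"
    by (simp add: power2_eq_square algebra_simps)
  also have "\<dots> = inner (g1 + g0) (g1 - g0)"
    by (simp add: power2_norm_eq_inner inner_add_left inner_diff_right inner_commute[of g0 g1])
  also have "\<dots> = \<tau> * (inner (g1 + g0) r - inner (g1 + g0) a)"
    by (simp add: diff inner_diff_right)
  also have "\<dots> \<le> \<tau> * (norm (g1 + g0) * norm r)"
  proof -
    have "inner (g1 + g0) r \<le> norm (g1 + g0) * norm r"
      by (rule norm_cauchy_schwarz)
    moreover have "0 \<le> inner (g1 + g0) a"
      using accretive by simp
    ultimately show ?thesis
      using assms(1) by (intro mult_left_mono) auto
  qed
  also have "\<dots> \<le> \<tau> * ((norm g1 + norm g0) * norm r)"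
    using assms(1) by (intro mult_left_mono mult_right_mono norm_triangle_ineq) auto
  finally have "(norm g1 + norm g0) * (norm g1 - norm g0) \<le> (norm g1 + norm g0) * (\<tau> * norm r)"
    by (simp add: algebra_simps)
  then show ?thesis
    using pos by (simp add: mult_le_cancel_left)
qed

text \<open>
  The hypothesis is stated with an arbitrary bound \<open>m\<close> of all preceding values because the
  extrapolation makes the recursion a two-step one; the right-hand side of the conclusion is increasing in
  \<open>n\<close> and serves as \<open>m\<close>.
\<close>

lemma discrete_Gronwall_running_bound:
  fixes x d :: "nat \<Rightarrow> real"
  assumes "0 \<le> a" "0 \<le> c" "0 \<le> \<tau>" "0 \<le> x 0"
    and d: "\<And>n. 0 \<le> d n"
    and step: "\<And>n m. n < N \<Longrightarrow> (\<And>k. k \<le> n \<Longrightarrow> x k \<le> m) \<Longrightarrow>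
      x (Suc n) \<le> (1 + a * \<tau>) * m + c * \<tau> * d n"
    and "n \<le> N"
  shows "x n \<le> (1 + a * \<tau>) ^ n * (x 0 + c * \<tau> * (\<Sum>k<n. d k))"
proof -
  define P where "P n = (1 + a * \<tau>) ^ n * (x 0 + c * \<tau> * (\<Sum>k<n. d k))" for n
  have q: "1 \<le> 1 + a * \<tau>"
    using assms(1-4) by simp
  have mono: "P i \<le> P j" if "i \<le> j" for i j
    unfolding P_def
  proof (rule mult_mono)
    show "(1 + a * \<tau>) ^ i \<le> (1 + a * \<tau>) ^ j"
      using that q by (rule power_increasing)
    have "(\<Sum>k<i. d k) \<le> (\<Sum>k<j. d k)"
      using that d by (intro sum_mono2) auto
    then show "x 0 + c * \<tau> * (\<Sum>k<i. d k) \<le> x 0 + c * \<tau> * (\<Sum>k<j. d k)"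
      using assms(1-4) by (simp add: mult_left_mono)
    show "0 \<le> (1 + a * \<tau>) ^ j"
      using q by simp
    show "0 \<le> x 0 + c * \<tau> * (\<Sum>k<i. d k)"
      using assms(1-4) d by (simp add: sum_nonneg)
  qed
  have "x n \<le> P n"
    using \<open>n \<le> N\<close>
  proof (induction n rule: less_induct)
    case (less n)
    show ?case
    proof (cases n)
      case 0
      then show ?thesis by (simp add: P_def)
    next
      case (Suc j)
      have "x k \<le> P j" if "k \<le> j" for k
        using less.IH[of k] mono[of k j] that Suc less.prems by linarith
      then have "x (Suc j) \<le> (1 + a * \<tau>) * P j + c * \<tau> * d j"
        using Suc less.prems by (intro step) auto
      also have "\<dots> \<le> (1 + a * \<tau>) * P j + (1 + a * \<tau>) ^ Suc j * (c * \<tau> * d j)"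
      proof -
        have "1 * (c * \<tau> * d j) \<le> (1 + a * \<tau>) ^ Suc j * (c * \<tau> * d j)"
          using assms(1-4) d[of j] q by (intro mult_right_mono one_le_power) auto
        then show ?thesis by simp
      qed
      also have "\<dots> = P (Suc j)"
        by (simp add: P_def algebra_simps)
      finally show ?thesis using Suc by simp
    qed
  qed
  then show ?thesis by (simp add: P_def)
qed

lemma discrete_Gronwall_squared:
  fixes x d :: "nat \<Rightarrow> real"
  assumes "0 \<le> a" "0 \<le> c" "0 \<le> \<tau>"
    and x: "\<And>n. 0 \<le> x n"
    and d: "\<And>n. 0 \<le> d n"
    and step: "\<And>n m. n < N \<Longrightarrow> (\<And>k. k \<le> n \<Longrightarrow> x k \<le> m) \<Longrightarrow>
      x (Suc n) \<le> (1 + a * \<tau>) * m + c * \<tau> * d n"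
    and N: "real N * \<tau> \<le> T"
  shows "(x N)\<^sup>2 \<le> 2 * exp (2 * a * T) * (1 + c\<^sup>2 * T) * ((x 0)\<^sup>2 + \<tau> * (\<Sum>k<N. (d k)\<^sup>2))"
proof -
  define s where "s = (\<Sum>k<N. d k)"
  define q where "q = (\<Sum>k<N. (d k)\<^sup>2)"
  have s0: "0 \<le> s" and q0: "0 \<le> q"
    unfolding s_def q_def by (auto intro: sum_nonneg d)
  have T0: "0 \<le> T"
    using N assms(3) by (smt (verit) mult_nonneg_nonneg of_nat_0_le_iff)
  have "x N \<le> (1 + a * \<tau>) ^ N * (x 0 + c * \<tau> * s)"
    unfolding s_def
    by (rule discrete_Gronwall_running_bound[where N = N]) (use assms(1-3) x d step in auto)
  also have "\<dots> \<le> exp (a * T) * (x 0 + c * \<tau> * s)"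
  proof (rule mult_right_mono)
    have "(1 + a * \<tau>) ^ N \<le> exp (a * \<tau>) ^ N"
      using assms(1-4) by (intro power_mono exp_ge_add_one_self) auto
    also have "\<dots> = exp (a * (real N * \<tau>))"
      by (simp add: exp_of_nat_mult[symmetric] algebra_simps)
    also have "\<dots> \<le> exp (a * T)"
      using N assms(1) by (simp add: mult_left_mono)
    finally show "(1 + a * \<tau>) ^ N \<le> exp (a * T)" .
    show "0 \<le> x 0 + c * \<tau> * s"
      using assms(1-4) s0 by simp
  qed
  finally have "(x N)\<^sup>2 \<le> (exp (a * T) * (x 0 + c * \<tau> * s))\<^sup>2"
    using x by (intro power_mono) auto
  also have "\<dots> = exp (2 * a * T) * (x 0 + c * \<tau> * s)\<^sup>2"
  proof -
    have "(exp (a * T))\<^sup>2 = exp (2 * a * T)"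
      by (simp add: power2_eq_square exp_add[symmetric])
    then show ?thesis by (simp add: power_mult_distrib)
  qed
  also have "\<dots> \<le> exp (2 * a * T) * (2 * (1 + c\<^sup>2 * T) * ((x 0)\<^sup>2 + \<tau> * q))"
  proof (rule mult_left_mono)
    have "(x 0 + c * \<tau> * s)\<^sup>2 \<le> 2 * (x 0)\<^sup>2 + 2 * (c * \<tau> * s)\<^sup>2"
      using sum_squares_bound[of "x 0" "c * \<tau> * s"] by (simp add: power2_sum)
    also have "(c * \<tau> * s)\<^sup>2 = c\<^sup>2 * \<tau>\<^sup>2 * s\<^sup>2"
      by (simp add: power_mult_distrib)
    also have "\<dots> \<le> c\<^sup>2 * \<tau>\<^sup>2 * (real N * q)"
    proof (rule mult_left_mono)
      \<comment> \<open>Cauchy--Schwarz against the constant sequence 1\<close>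
      show "s\<^sup>2 \<le> real N * q"
        using Cauchy_Schwarz_ineq_sum[of "\<lambda>_. 1" d "{..<N}"] by (simp add: s_def q_def)
    qed simp
    also have "\<dots> = c\<^sup>2 * (real N * \<tau>) * (\<tau> * q)"
      by (simp add: power2_eq_square)
    also have "\<dots> \<le> c\<^sup>2 * T * (\<tau> * q)"
      using N assms(1-4) q0 by (intro mult_right_mono mult_left_mono) auto
    finally have "(x 0 + c * \<tau> * s)\<^sup>2 \<le> 2 * (x 0)\<^sup>2 + 2 * (c\<^sup>2 * T * (\<tau> * q))"
      by simp
    moreover have "0 \<le> c\<^sup>2 * T * (x 0)\<^sup>2" "0 \<le> \<tau> * q"
      using T0 q0 assms(3) by auto
    ultimately show "(x 0 + c * \<tau> * s)\<^sup>2 \<le> 2 * (1 + c\<^sup>2 * T) * ((x 0)\<^sup>2 + \<tau> * q)"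
      by (simp add: algebra_simps)
  qed simp
  finally show ?thesis
    by (simp add: q_def algebra_simps)
qed

lemma midpoint_extrapolation_diff:
  "midpoint_extrapolation (\<lambda>n. u n - v n) n = midpoint_extrapolation u n - midpoint_extrapolation v n"
  by (simp add: midpoint_extrapolation_def algebra_simps)

lemma midpoint_extrapolation_linear_image:
  assumes "linear h"
  shows "h (midpoint_extrapolation u n) = midpoint_extrapolation (\<lambda>n. h (u n)) n"
  by (simp add: midpoint_extrapolation_def linear_add[OF assms] linear_diff[OF assms] linear_cmul[OF assms])

lemma norm_midpoint_extrapolation_le:
  fixes u :: "nat \<Rightarrow> 'a::real_normed_vector"
  assumes "\<And>k. k \<le> n \<Longrightarrow> norm (u k) \<le> m"
  shows "norm (midpoint_extrapolation u n) \<le> 2 * m"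
proof (cases n)
  case 0
  then show ?thesis
    using assms[of 0] norm_ge_zero[of "u 0"] by (simp add: midpoint_extrapolation_def del: norm_ge_zero)
next
  case (Suc j)
  have "midpoint_extrapolation u n = u n + (1 / 2) *\<^sub>R (u n - u j)"
    using Suc by (simp add: midpoint_extrapolation_def)
  then have "norm (midpoint_extrapolation u n) \<le> norm (u n) + norm ((1 / 2) *\<^sub>R (u n - u j))"
    using norm_triangle_ineq by metis
  also have "\<dots> \<le> norm (u n) + (norm (u n) + norm (u j)) / 2"
    using norm_triangle_ineq4[of "u n" "u j"] by simp
  also have "\<dots> \<le> m + (m + m) / 2"
    using assms[of n] assms[of j] Suc by (intro add_mono divide_right_mono) auto
  finally show ?thesis by simp
qed

section \<open>One step of the error recursion\<close>

context kato_setting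
begin

lemma emb_linear: "linear emb"
  using emb_bounded_linear by (rule bounded_linear.linear)

lemma inv_emb [simp]: "inv emb (emb y) = y"
  using emb_inj by simp

lemma S_inj: "inj S"
  unfolding linear_injective_0[OF S_linear] by (metis S_isometry norm_eq_zero)

lemma inv_S [simp]: "inv S (S y) = y"
  using S_inj by simp

lemma emb_in_D [simp]: "emb w \<in> D y"
  using range_emb_subset_D by blast

lemma A_diff:
  assumes "v \<in> D y" "w \<in> D y"
  shows "v - w \<in> D y" "A y (v - w) = A y v - A y w"
proof -
  have sub: "subspace (D y)"
    and add: "\<And>v w. v \<in> D y \<Longrightarrow> w \<in> D y \<Longrightarrow> A y (v + w) = A y v + A y w"
    using A_closed[of y] by (auto simp: closed_linear_operator_def)
  show vw: "v - w \<in> D y"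
    using sub assms by (rule subspace_diff)
  show "A y (v - w) = A y v - A y w"
    using add[OF vw assms(2)] by simp
qed

text \<open>
  The set in the domain condition of the commutator contains \<open>S w\<close> as soon as \<open>A y\<close> maps \<open>emb w\<close> into
  \<open>Y\<close>. For the midpoints in both schemes this is the case, as all other terms of the equation
  lie in \<open>Y\<close>; this is what allows \<open>S\<close> to be applied to the schemes.
\<close>

lemma S_in_D_if_A_in_range:
  assumes "A y (emb w) \<in> range emb"
  shows "S w \<in> D y"
proof -
  have "S w \<in> {v \<in> range S. emb (inv S v) \<in> D y \<and> A y (emb (inv S v)) \<in> range emb}"
    using assms by simp
  then show ?thesis
    by (simp only: commutator_domain)
qed

lemma S_A_eq:
  assumes "A y (emb w) = emb z"
  shows "S z = A y (S w) + B y (S w)"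
  using commutator[OF S_in_D_if_A_in_range, of y w] assms by simp

lemma error_step_X:
  assumes "0 < \<tau>" "0 < r" "norm y \<le> r" "norm y' \<le> r"
    and eq: "(1 / \<tau>) *\<^sub>R (emb u1 - emb u0) + A y ((1 / 2) *\<^sub>R (emb u1 + emb u0)) = f (emb y)"
    and eq': "(1 / \<tau>) *\<^sub>R (emb v1 - emb v0) + A y' ((1 / 2) *\<^sub>R (emb v1 + emb v0)) = f (emb y') + emb d"
    and R: "norm ((1 / 2) *\<^sub>R (v1 + v0)) \<le> R"
  shows "norm (emb (u1 - v1)) \<le> norm (emb (u0 - v0)) +
    \<tau> * ((\<bar>LA r\<bar> * R + \<bar>lX r\<bar>) * norm (emb (y - y')) + norm (emb d))"
proof -
  note emb_simps = linear_diff[OF emb_linear] linear_add[OF emb_linear] linear_cmul[OF emb_linear]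
  define p where "p = (1 / 2) *\<^sub>R (u1 + u0)"
  define q where "q = (1 / 2) *\<^sub>R (v1 + v0)"
  define g where "g = (f (emb y) - f (emb y')) - (A y (emb q) - A y' (emb q)) - emb d"
  have p: "(1 / 2) *\<^sub>R (emb u1 + emb u0) = emb p" and q: "(1 / 2) *\<^sub>R (emb v1 + emb v0) = emb q"
    by (simp_all add: p_def q_def emb_simps)
  have mid: "(1 / 2) *\<^sub>R (emb (u1 - v1) + emb (u0 - v0)) = emb p - emb q"
    by (simp add: p_def q_def emb_simps algebra_simps)
  have "(1 / \<tau>) *\<^sub>R (emb (u1 - v1) - emb (u0 - v0)) =
      (1 / \<tau>) *\<^sub>R (emb u1 - emb u0) - (1 / \<tau>) *\<^sub>R (emb v1 - emb v0)"
    by (simp add: emb_simps algebra_simps)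
  also have "\<dots> = (f (emb y) - A y (emb p)) - (f (emb y') + emb d - A y' (emb q))"
    using eq eq' unfolding p q by (metis add_diff_cancel_right')
  finally have "(1 / \<tau>) *\<^sub>R (emb (u1 - v1) - emb (u0 - v0)) + A y (emb p - emb q) = g"
    by (simp add: g_def A_diff)
  moreover have "0 \<le> inner (emb p - emb q) (A y (emb p - emb q))"
    by (intro A_accretive A_diff) simp_all
  ultimately have le: "norm (emb (u1 - v1)) \<le> norm (emb (u0 - v0)) + \<tau> * norm g"
    using \<open>0 < \<tau>\<close> by (intro accretive_midpoint_step) (simp_all only: mid)
  have "norm g \<le> (\<bar>LA r\<bar> * R + \<bar>lX r\<bar>) * norm (emb (y - y')) + norm (emb d)"
  proof -
    have "norm (f (emb y) - f (emb y')) \<le> lX r * norm (emb (y - y'))"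
      using assms(2-4) by (rule f_Lipschitz_X)
    also have "\<dots> \<le> \<bar>lX r\<bar> * norm (emb (y - y'))"
      by (intro mult_right_mono) auto
    finally have 1: "norm (f (emb y) - f (emb y')) \<le> \<bar>lX r\<bar> * norm (emb (y - y'))" .
    have "norm (A y (emb q) - A y' (emb q)) \<le> LA r * norm (emb (y - y')) * norm q"
      using assms(2-4) by (rule A_Lipschitz)
    also have "\<dots> \<le> \<bar>LA r\<bar> * norm (emb (y - y')) * R"
      using R unfolding q_def by (intro mult_mono) auto
    finally have 2: "norm (A y (emb q) - A y' (emb q)) \<le> \<bar>LA r\<bar> * R * norm (emb (y - y'))"
      by (simp add: algebra_simps)
    have "norm g \<le> norm (f (emb y) - f (emb y')) + norm (A y (emb q) - A y' (emb q)) + norm (emb d)"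
      unfolding g_def
      by (rule order_trans[OF norm_triangle_ineq4 add_right_mono])+ (rule order_refl)
    with 1 2 show ?thesis by (simp add: algebra_simps)
  qed
  then have "\<tau> * norm g \<le> \<tau> * ((\<bar>LA r\<bar> * R + \<bar>lX r\<bar>) * norm (emb (y - y')) + norm (emb d))"
    using \<open>0 < \<tau>\<close> by (intro mult_left_mono) auto
  with le show ?thesis by linarith
qed

text \<open>
  The estimate of the error in \<open>Y\<close> is the energy inequality for \<open>S\<close> applied to the error. The term with
  \<open>MB\<close> contains the new error and comes from \<open>B y\<close> acting on the midpoint.
\<close>

lemma error_step_Y:
  assumes "0 < \<tau>" "0 < r" "norm y \<le> r" "norm y' \<le> r"
    and eq: "(1 / \<tau>) *\<^sub>R (emb u1 - emb u0) + A y ((1 / 2) *\<^sub>R (emb u1 + emb u0)) = f (emb y)"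
    and eq': "(1 / \<tau>) *\<^sub>R (emb v1 - emb v0) + A y' ((1 / 2) *\<^sub>R (emb v1 + emb v0)) = f (emb y') + emb d"
    and R: "norm ((1 / 2) *\<^sub>R (v1 + v0)) \<le> R"
    and w: "emb w = S ((1 / 2) *\<^sub>R (v1 + v0))" and K: "norm w \<le> K"
  shows "norm (u1 - v1) \<le> norm (u0 - v0) +
    \<tau> * (\<bar>MB r\<bar> * ((norm (u1 - v1) + norm (u0 - v0)) / 2)
      + (\<bar>LA r\<bar> * K + \<bar>LB r\<bar> * R + \<bar>lY r\<bar>) * norm (y - y') + norm d)"
proof -
  note emb_simps = linear_diff[OF emb_linear] linear_add[OF emb_linear] linear_cmul[OF emb_linear]
  note S_simps = linear_diff[OF S_linear] linear_add[OF S_linear] linear_cmul[OF S_linear]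
  define p where "p = (1 / 2) *\<^sub>R (u1 + u0)"
  define q where "q = (1 / 2) *\<^sub>R (v1 + v0)"
  have p: "(1 / 2) *\<^sub>R (emb u1 + emb u0) = emb p" and q: "(1 / 2) *\<^sub>R (emb v1 + emb v0) = emb q"
    by (simp_all add: p_def q_def emb_simps)
  have mid: "(1 / 2) *\<^sub>R (S (u1 - v1) + S (u0 - v0)) = S p - S q"
    by (simp add: p_def q_def S_simps algebra_simps)
  have Sq: "S q = emb w"
    using w by (simp add: q_def)
  obtain fy where fy: "f (emb y) = emb fy"
    using f_maps_Y by blast
  obtain fy' where fy': "f (emb y') = emb fy'"
    using f_maps_Y by blast
  \<comment> \<open>all terms of the two equations lie in \<open>Y\<close>, so that \<open>S\<close> can be applied to their difference\<close>
  have Ap: "A y (emb p) = emb (fy - (1 / \<tau>) *\<^sub>R (u1 - u0))"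
    using eq unfolding p fy by (simp add: emb_simps algebra_simps)
  have Aq': "A y' (emb q) = emb (fy' + d - (1 / \<tau>) *\<^sub>R (v1 - v0))"
    using eq' unfolding q fy' by (simp add: emb_simps algebra_simps)
  have SpD: "S p \<in> D y"
    using Ap S_in_D_if_A_in_range by simp
  have Sp: "S (fy - (1 / \<tau>) *\<^sub>R (u1 - u0)) = A y (S p) + B y (S p)"
    using Ap by (rule S_A_eq)
  have Sq': "S (fy' + d - (1 / \<tau>) *\<^sub>R (v1 - v0)) = A y' (S q) + B y' (S q)"
    using Aq' by (rule S_A_eq)
  define g where "g = S (fy - fy') - (A y (emb w) - A y' (emb w)) - (B y (S q) - B y' (S q))
    - S d - B y (S p - S q)"
  have "(1 / \<tau>) *\<^sub>R (S (u1 - v1) - S (u0 - v0)) =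
      (S fy - S (fy - (1 / \<tau>) *\<^sub>R (u1 - u0))) - (S (fy' + d) - S (fy' + d - (1 / \<tau>) *\<^sub>R (v1 - v0)))"
    by (simp add: S_simps algebra_simps)
  also have "\<dots> = (S fy - A y (S p) - B y (S p)) - (S (fy' + d) - A y' (S q) - B y' (S q))"
    unfolding Sp Sq' by simp
  also have "\<dots> = g - A y (S p - S q)"
    using SpD by (simp add: g_def Sq A_diff S_simps linear_diff[OF B_linear])
  finally have "(1 / \<tau>) *\<^sub>R (S (u1 - v1) - S (u0 - v0)) + A y (S p - S q) = g"
    by simp
  moreover have "0 \<le> inner (S p - S q) (A y (S p - S q))"
    using SpD by (intro A_accretive A_diff) (simp_all add: Sq)
  ultimately have le: "norm (S (u1 - v1)) \<le> norm (S (u0 - v0)) + \<tau> * norm g"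
    using \<open>0 < \<tau>\<close> by (intro accretive_midpoint_step) (simp_all only: mid)
  have "norm g \<le> \<bar>MB r\<bar> * ((norm (u1 - v1) + norm (u0 - v0)) / 2)
      + (\<bar>LA r\<bar> * K + \<bar>LB r\<bar> * R + \<bar>lY r\<bar>) * norm (y - y') + norm d"
  proof -
    have "norm (fy - fy') = norm (inv emb (f (emb y) - f (emb y')))"
      by (simp add: fy fy' flip: emb_simps)
    also have "\<dots> \<le> lY r * norm (y - y')"
      using assms(2-4) by (rule f_Lipschitz_Y)
    also have "\<dots> \<le> \<bar>lY r\<bar> * norm (y - y')"
      by (intro mult_right_mono) auto
    finally have 1: "norm (S (fy - fy')) \<le> \<bar>lY r\<bar> * norm (y - y')"
      by (simp add: S_isometry)
    have "norm (A y (emb w) - A y' (emb w)) \<le> LA r * norm (emb (y - y')) * norm w"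
      using assms(2-4) by (rule A_Lipschitz)
    also have "\<dots> \<le> \<bar>LA r\<bar> * norm (y - y') * K"
      using K emb_norm_le[of "y - y'"] by (intro mult_mono) auto
    finally have 2: "norm (A y (emb w) - A y' (emb w)) \<le> \<bar>LA r\<bar> * K * norm (y - y')"
      by (simp add: algebra_simps)
    have "norm (B y (S q) - B y' (S q)) \<le> LB r * norm (y - y') * norm (S q)"
      using assms(2-4) by (rule B_Lipschitz)
    also have "\<dots> \<le> \<bar>LB r\<bar> * norm (y - y') * R"
      using R unfolding S_isometry q_def by (intro mult_mono) auto
    finally have 3: "norm (B y (S q) - B y' (S q)) \<le> \<bar>LB r\<bar> * R * norm (y - y')"
      by (simp add: algebra_simps)
    have "norm (B y (S p - S q)) \<le> MB r * norm (S p - S q)"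
      using assms(2,3) by (rule B_bound)
    also have "\<dots> \<le> \<bar>MB r\<bar> * ((norm (u1 - v1) + norm (u0 - v0)) / 2)"
    proof (intro mult_mono)
      have "norm (S p - S q) = norm (S (u1 - v1) + S (u0 - v0)) / 2"
        unfolding mid[symmetric] by simp
      also have "\<dots> \<le> (norm (u1 - v1) + norm (u0 - v0)) / 2"
        using norm_triangle_ineq[of "S (u1 - v1)" "S (u0 - v0)"] by (simp add: S_isometry)
      finally show "norm (S p - S q) \<le> (norm (u1 - v1) + norm (u0 - v0)) / 2" .
    qed auto
    finally have 4: "norm (B y (S p - S q)) \<le> \<bar>MB r\<bar> * ((norm (u1 - v1) + norm (u0 - v0)) / 2)" .
    have "norm g \<le> norm (S (fy - fy')) + norm (A y (emb w) - A y' (emb w))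
        + norm (B y (S q) - B y' (S q)) + norm (S d) + norm (B y (S p - S q))"
      unfolding g_def
      by (rule order_trans[OF norm_triangle_ineq4 add_right_mono])+ (rule order_refl)
    with 1 2 3 4 show ?thesis
      by (simp add: S_isometry distrib_right)
  qed
  then have "\<tau> * norm g \<le> \<tau> * (\<bar>MB r\<bar> * ((norm (u1 - v1) + norm (u0 - v0)) / 2)
      + (\<bar>LA r\<bar> * K + \<bar>LB r\<bar> * R + \<bar>lY r\<bar>) * norm (y - y') + norm d)"
    using \<open>0 < \<tau>\<close> by (intro mult_left_mono) auto
  with le show ?thesis
    unfolding S_isometry by linarith
qed

end

text \<open>
  With \<open>s = \<tau> * M \<le> 1\<close>, multiplying by \<open>1 + s\<close> removes the factor \<open>1 - s / 2\<close> on the left,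
  because \<open>(1 + s) * (1 - s / 2) \<ge> 1\<close>, while \<open>(1 + s) * (1 + s / 2) \<le> 1 + 2 * s\<close> on the right.
\<close>

lemma absorb_implicit_midpoint_term:
  fixes x0 x1 :: real
  assumes "0 \<le> M" "0 \<le> \<tau>" "\<tau> * M \<le> 1" "0 \<le> x1" "0 \<le> x0" "0 \<le> h"
    and le: "x1 \<le> x0 + \<tau> * (M * ((x1 + x0) / 2) + h)"
  shows "x1 \<le> (1 + 2 * (\<tau> * M)) * x0 + 2 * \<tau> * h"
proof -
  define s where "s = \<tau> * M"
  have s: "0 \<le> s" "s \<le> 1"
    using assms by (auto simp: s_def)
  have ss: "s * s \<le> s"
    using s mult_left_le by blast
  have "1 * x1 \<le> ((1 + s) * (1 - s / 2)) * x1"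
    using ss assms(4) by (intro mult_right_mono) (auto simp: field_simps)
  also have "\<dots> = (1 + s) * ((1 - s / 2) * x1)"
    by simp
  also have "\<dots> \<le> (1 + s) * ((1 + s / 2) * x0 + \<tau> * h)"
    using s le by (intro mult_left_mono) (auto simp: s_def field_simps)
  also have "\<dots> = ((1 + s) * (1 + s / 2)) * x0 + (1 + s) * (\<tau> * h)"
    by (simp add: distrib_left)
  also have "\<dots> \<le> (1 + 2 * s) * x0 + 2 * (\<tau> * h)"
    using ss s assms by (intro add_mono mult_right_mono) (auto simp: field_simps)
  finally show ?thesis
    by (simp add: s_def mult.assoc)
qed

section \<open>Stability\<close>

theorem lemma3p2:
  fixes emb :: "'y::{real_inner, complete_space} \<Rightarrow> 'x::{real_inner, complete_space}"
    and D :: "'y \<Rightarrow> 'x set"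
    and A B :: "'y \<Rightarrow> 'x \<Rightarrow> 'x"
    and S :: "'y \<Rightarrow> 'x"
    and f :: "'x \<Rightarrow> 'x"
    and MA MB LA LB lX lY :: "real \<Rightarrow> real"
    and R T :: real
  assumes "kato_setting emb D A B S f MA MB LA LB lX lY"
    and "R > 0" and "T > 0"
  shows "\<exists>C\<^sub>X :: real. \<forall>K :: real. \<exists>\<tau>\<^sub>0 > 0. \<exists>\<delta> > 0. \<exists>C\<^sub>Y :: real.
    \<forall>(\<tau> :: real) (u :: nat \<Rightarrow> 'y) (u' :: nat \<Rightarrow> 'y) (d :: nat \<Rightarrow> 'y).
      0 < \<tau> \<and> \<tau> \<le> \<tau>\<^sub>0 \<and>
      implicit_midpoint_solution emb A f \<tau> T u (\<lambda>n. 0) \<and>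
      implicit_midpoint_solution emb A f \<tau> T u' d \<and>
      (\<forall>n. real n * \<tau> \<le> T \<longrightarrow>
         norm (u' n) \<le> R \<and> (\<exists>v. emb v = S (u' n) \<and> norm v \<le> K)) \<and>
      (norm (u 0 - u' 0))\<^sup>2 + \<tau> * (\<Sum>n | real n * \<tau> \<le> T. (norm (d n))\<^sup>2) \<le> \<delta>\<^sup>2
      \<longrightarrow>
      (\<forall>n. real n * \<tau> \<le> T \<longrightarrow>
         (norm (u n - u' n))\<^sup>2
           \<le> C\<^sub>Y * ((norm (u 0 - u' 0))\<^sup>2 + \<tau> * (\<Sum>k<n. (norm (d k))\<^sup>2)) \<and>
         (norm (emb (u n - u' n)))\<^sup>2
           \<le> C\<^sub>X * ((norm (emb (u 0 - u' 0)))\<^sup>2 + \<tau> * (\<Sum>k<n. (norm (emb (d k)))\<^sup>2)))"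
proof -
  interpret kato_setting emb D A B S f MA MB LA LB lX lY
    by (rule assms(1))
  define r where "r = 4 * R"
  have r: "0 < r"
    using \<open>R > 0\<close> by (simp add: r_def)
  define a where "a = \<bar>LA r\<bar> * R + \<bar>lX r\<bar>"
  have a: "0 \<le> a"
    using \<open>R > 0\<close> by (simp add: a_def)
  define C\<^sub>X where "C\<^sub>X = 2 * exp (2 * (2 * a) * T) * (1 + 1\<^sup>2 * T)"
  have main: "\<exists>\<tau>\<^sub>0 > 0. \<exists>\<delta> > 0. \<exists>C\<^sub>Y :: real.
    \<forall>(\<tau> :: real) (u :: nat \<Rightarrow> 'y) (u' :: nat \<Rightarrow> 'y) (d :: nat \<Rightarrow> 'y).
      0 < \<tau> \<and> \<tau> \<le> \<tau>\<^sub>0 \<and>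
      implicit_midpoint_solution emb A f \<tau> T u (\<lambda>n. 0) \<and>
      implicit_midpoint_solution emb A f \<tau> T u' d \<and>
      (\<forall>n. real n * \<tau> \<le> T \<longrightarrow>
         norm (u' n) \<le> R \<and> (\<exists>v. emb v = S (u' n) \<and> norm v \<le> K)) \<and>
      (norm (u 0 - u' 0))\<^sup>2 + \<tau> * (\<Sum>n | real n * \<tau> \<le> T. (norm (d n))\<^sup>2) \<le> \<delta>\<^sup>2
      \<longrightarrow>
      (\<forall>n. real n * \<tau> \<le> T \<longrightarrow>
         (norm (u n - u' n))\<^sup>2
           \<le> C\<^sub>Y * ((norm (u 0 - u' 0))\<^sup>2 + \<tau> * (\<Sum>k<n. (norm (d k))\<^sup>2)) \<and>
         (norm (emb (u n - u' n)))\<^sup>2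
           \<le> C\<^sub>X * ((norm (emb (u 0 - u' 0)))\<^sup>2 + \<tau> * (\<Sum>k<n. (norm (emb (d k)))\<^sup>2)))"
    for K
  proof -
    define M where "M = \<bar>MB r\<bar>"
    define b where "b = \<bar>LA r\<bar> * \<bar>K\<bar> + \<bar>LB r\<bar> * R + \<bar>lY r\<bar>"
    have M: "0 \<le> M" and b: "0 \<le> b"
      using \<open>R > 0\<close> by (simp_all add: M_def b_def)
    define C\<^sub>Y where "C\<^sub>Y = 2 * exp (2 * (2 * M + 4 * b) * T) * (1 + 2\<^sup>2 * T)"
    have CY: "0 < C\<^sub>Y"
      using \<open>T > 0\<close> by (auto simp: C\<^sub>Y_def intro!: mult_pos_pos add_pos_pos)
    define \<tau>\<^sub>0 where "\<tau>\<^sub>0 = 1 / (M + 1)"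
    \<comment> \<open>chosen so that the bound \<open>C\<^sub>Y * \<delta>\<^sup>2\<close> on the squared error is \<open>R\<^sup>2\<close>\<close>
    define \<delta> where "\<delta> = R / sqrt C\<^sub>Y"
    have "0 < \<tau>\<^sub>0"
      using M by (simp add: \<tau>\<^sub>0_def)
    moreover have "0 < \<delta>"
      using \<open>R > 0\<close> CY by (simp add: \<delta>_def)
    moreover have
      "(norm (u n - u' n))\<^sup>2
           \<le> C\<^sub>Y * ((norm (u 0 - u' 0))\<^sup>2 + \<tau> * (\<Sum>k<n. (norm (d k))\<^sup>2)) \<and>
       (norm (emb (u n - u' n)))\<^sup>2
           \<le> C\<^sub>X * ((norm (emb (u 0 - u' 0)))\<^sup>2 + \<tau> * (\<Sum>k<n. (norm (emb (d k)))\<^sup>2))"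
      if \<tau>: "0 < \<tau>" "\<tau> \<le> \<tau>\<^sub>0"
        and u: "implicit_midpoint_solution emb A f \<tau> T u (\<lambda>n. 0)"
        and u': "implicit_midpoint_solution emb A f \<tau> T u' d"
        and bound: "\<And>n. real n * \<tau> \<le> T \<Longrightarrow>
          norm (u' n) \<le> R \<and> (\<exists>v. emb v = S (u' n) \<and> norm v \<le> K)"
        and small: "(norm (u 0 - u' 0))\<^sup>2 + \<tau> * (\<Sum>n | real n * \<tau> \<le> T. (norm (d n))\<^sup>2) \<le> \<delta>\<^sup>2"
        and nT: "real n * \<tau> \<le> T"
      for \<tau> u u' d n
    proof -
      have \<tau>M: "\<tau> * M \<le> 1"
      proof -
        have "\<tau> * M \<le> \<tau>\<^sub>0 * M"
          using \<tau> M by (intro mult_right_mono) auto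
        also have "\<dots> \<le> 1"
          using M by (simp add: \<tau>\<^sub>0_def)
        finally show ?thesis .
      qed
      have before_T: "real j * \<tau> \<le> T" if "j \<le> k" "real k * \<tau> \<le> T" for j k
        using that \<tau> by (smt (verit) mult_right_mono of_nat_mono)
      have fin: "finite {n. real n * \<tau> \<le> T}"
      proof (rule finite_subset)
        show "{n. real n * \<tau> \<le> T} \<subseteq> {..nat \<lfloor>T / \<tau>\<rfloor>}"
          using \<tau> by (auto simp: le_nat_floor pos_le_divide_eq)
      qed simp
      define e where "e n = u n - u' n" for n
      have Y_step: "norm (e (Suc j)) \<le> (1 + (2 * M + 4 * b) * \<tau>) * m + 2 * \<tau> * norm (d j)"
        and X_step: "norm (emb (e (Suc j))) \<le> (1 + (2 * a) * \<tau>) * m' + 1 * \<tau> * norm (emb (d j))"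
        if jT: "real (Suc j) * \<tau> \<le> T"
          and boot: "\<And>k. k \<le> j \<Longrightarrow> norm (e k) \<le> R"
          and m: "\<And>k. k \<le> j \<Longrightarrow> norm (e k) \<le> m"
          and m': "\<And>k. k \<le> j \<Longrightarrow> norm (emb (e k)) \<le> m'"
        for j m m'
      proof -
        define y where "y = midpoint_extrapolation u j"
        define y' where "y' = midpoint_extrapolation u' j"
        have jT': "real j * \<tau> \<le> T"
          using before_T[OF _ jT, of j] by simp
        have u'R: "norm (u' k) \<le> R" if "k \<le> Suc j" for k
          using bound before_T[OF that jT] by blast
        have uR: "norm (u k) \<le> 2 * R" if "k \<le> j" for k
          using norm_triangle_ineq[of "e k" "u' k"] boot[OF that] u'R[of k] that by (simp add: e_def)
        have y: "norm y \<le> r" and y': "norm y' \<le> r"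
          using norm_midpoint_extrapolation_le[of j u "2 * R"] uR
            norm_midpoint_extrapolation_le[of j u' R] u'R \<open>R > 0\<close>
          by (simp_all add: y_def y'_def r_def order_trans[of _ "2 * R"])
        have yy': "y - y' = midpoint_extrapolation e j"
          by (simp add: y_def y'_def e_def[abs_def] midpoint_extrapolation_diff)
        have eq: "(1 / \<tau>) *\<^sub>R (emb (u (Suc j)) - emb (u j))
            + A y ((1 / 2) *\<^sub>R (emb (u (Suc j)) + emb (u j))) = f (emb y)"
          using u jT' by (simp add: implicit_midpoint_solution_def y_def linear_0[OF emb_linear])
        have eq': "(1 / \<tau>) *\<^sub>R (emb (u' (Suc j)) - emb (u' j))
            + A y' ((1 / 2) *\<^sub>R (emb (u' (Suc j)) + emb (u' j))) = f (emb y') + emb (d j)"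
          using u' jT' by (simp add: implicit_midpoint_solution_def y'_def)
        have R: "norm ((1 / 2) *\<^sub>R (u' (Suc j) + u' j)) \<le> R"
          using norm_triangle_ineq[of "u' (Suc j)" "u' j"] u'R[of j] u'R[of "Suc j"] by simp
        obtain v1 v0 where v: "emb v1 = S (u' (Suc j))" "norm v1 \<le> K" "emb v0 = S (u' j)" "norm v0 \<le> K"
          using bound[OF jT] bound[OF jT'] by blast
        define w where "w = (1 / 2) *\<^sub>R (v1 + v0)"
        have w: "emb w = S ((1 / 2) *\<^sub>R (u' (Suc j) + u' j))"
          using v by (simp add: w_def linear_add[OF emb_linear] linear_cmul[OF emb_linear]
              linear_add[OF S_linear] linear_cmul[OF S_linear])
        have K: "norm w \<le> \<bar>K\<bar>"
          using norm_triangle_ineq[of v1 v0] v by (simp add: w_def)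

        have hatY: "norm (y - y') \<le> 2 * m"
          unfolding yy' by (rule norm_midpoint_extrapolation_le) (rule m)
        have hatX: "norm (emb (y - y')) \<le> 2 * m'"
          unfolding yy' midpoint_extrapolation_linear_image[OF emb_linear]
          by (rule norm_midpoint_extrapolation_le) (rule m')

        have "norm (e (Suc j)) \<le> norm (e j) +
            \<tau> * (M * ((norm (e (Suc j)) + norm (e j)) / 2) + (b * norm (y - y') + norm (d j)))"
          using error_step_Y[OF \<tau>(1) r y y' eq eq' R w K] by (simp add: e_def M_def b_def algebra_simps)
        then have "norm (e (Suc j)) \<le> (1 + 2 * (\<tau> * M)) * norm (e j)
            + 2 * \<tau> * (b * norm (y - y') + norm (d j))"
          using \<tau> \<tau>M M b by (intro absorb_implicit_midpoint_term) auto
        also have "\<dots> \<le> (1 + 2 * (\<tau> * M)) * m + 2 * \<tau> * (b * (2 * m) + norm (d j))"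
          using m[of j] hatY \<tau> M b
          by (intro add_mono mult_left_mono) auto
        finally show "norm (e (Suc j)) \<le> (1 + (2 * M + 4 * b) * \<tau>) * m + 2 * \<tau> * norm (d j)"
          by (simp add: algebra_simps)

        have "norm (emb (e (Suc j))) \<le> norm (emb (e j))
            + \<tau> * (a * norm (emb (y - y')) + norm (emb (d j)))"
          using error_step_X[OF \<tau>(1) r y y' eq eq' R] by (simp add: e_def a_def)
        also have "\<dots> \<le> m' + \<tau> * (a * (2 * m') + norm (emb (d j)))"
          using m'[of j] hatX \<tau> a by (intro add_mono mult_left_mono) auto
        finally show "norm (emb (e (Suc j))) \<le> (1 + (2 * a) * \<tau>) * m' + 1 * \<tau> * norm (emb (d j))"
          by (simp add: algebra_simps)
      qed
      have Y_estimate: "(norm (e k))\<^sup>2 \<le> C\<^sub>Y * ((norm (e 0))\<^sup>2 + \<tau> * (\<Sum>i<k. (norm (d i))\<^sup>2))"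
        if kT: "real k * \<tau> \<le> T" and boot: "\<And>j. j < k \<Longrightarrow> norm (e j) \<le> R" for k
        unfolding C\<^sub>Y_def
      proof (rule discrete_Gronwall_squared[where x = "\<lambda>n. norm (e n)" and d = "\<lambda>n. norm (d n)"])
        fix j m
        assume j: "j < k" and m: "\<And>i. i \<le> j \<Longrightarrow> norm (e i) \<le> m"
        show "norm (e (Suc j)) \<le> (1 + (2 * M + 4 * b) * \<tau>) * m + 2 * \<tau> * norm (d j)"
        proof (rule Y_step)
          show "real (Suc j) * \<tau> \<le> T"
            using before_T[OF _ kT, of "Suc j"] j by simp
          show "norm (e i) \<le> R" if "i \<le> j" for i
            using boot[of i] that j by simp
          show "norm (emb (e i)) \<le> m" if "i \<le> j" for i
            using emb_norm_le m[OF that] by (rule order_trans)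
        qed (rule m)
      qed (use M b \<tau> kT in auto)
      have e_small: "norm (e k) \<le> R" if "real k * \<tau> \<le> T" for k
        using that
      proof (induction k rule: less_induct)
        case (less k)
        have "(norm (e k))\<^sup>2 \<le> C\<^sub>Y * ((norm (e 0))\<^sup>2 + \<tau> * (\<Sum>i<k. (norm (d i))\<^sup>2))"
          using less.prems
        proof (rule Y_estimate)
          show "norm (e j) \<le> R" if "j < k" for j
            using less.IH[OF that] before_T[OF _ less.prems, of j] that by simp
        qed
        also have "\<dots> \<le> C\<^sub>Y * \<delta>\<^sup>2"
        proof (rule mult_left_mono)
          have "(\<Sum>i<k. (norm (d i))\<^sup>2) \<le> (\<Sum>n | real n * \<tau> \<le> T. (norm (d n))\<^sup>2)"
            using before_T[OF _ less.prems] by (intro sum_mono2 fin) auto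
          then have "\<tau> * (\<Sum>i<k. (norm (d i))\<^sup>2) \<le> \<tau> * (\<Sum>n | real n * \<tau> \<le> T. (norm (d n))\<^sup>2)"
            using \<tau> by (intro mult_left_mono) auto
          then show "(norm (e 0))\<^sup>2 + \<tau> * (\<Sum>i<k. (norm (d i))\<^sup>2) \<le> \<delta>\<^sup>2"
            using small by (simp add: e_def)
        qed (use CY in simp)
        also have "\<dots> = R\<^sup>2"
          using CY by (simp add: \<delta>_def power_divide)
        finally show ?case
          using \<open>R > 0\<close> by (simp add: abs_le_square_iff[symmetric])
      qed
      have boot: "norm (e j) \<le> R" if "j \<le> n" for j
        using e_small before_T[OF that nT] by blast
      have "(norm (emb (e n)))\<^sup>2
          \<le> C\<^sub>X * ((norm (emb (e 0)))\<^sup>2 + \<tau> * (\<Sum>k<n. (norm (emb (d k)))\<^sup>2))"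
        unfolding C\<^sub>X_def
      proof (rule discrete_Gronwall_squared
          [where x = "\<lambda>n. norm (emb (e n))" and d = "\<lambda>n. norm (emb (d n))"])
        fix j m
        assume j: "j < n" and m: "\<And>i. i \<le> j \<Longrightarrow> norm (emb (e i)) \<le> m"
        show "norm (emb (e (Suc j))) \<le> (1 + (2 * a) * \<tau>) * m + 1 * \<tau> * norm (emb (d j))"
        proof (rule X_step)
          show "real (Suc j) * \<tau> \<le> T"
            using before_T[OF _ nT, of "Suc j"] j by simp
          show "norm (e i) \<le> R" "norm (e i) \<le> R" if "i \<le> j" for i
            using boot[of i] that j by simp_all
        qed (rule m)
      qed (use a \<tau> nT in auto)
      moreover have "(norm (e n))\<^sup>2 \<le> C\<^sub>Y * ((norm (e 0))\<^sup>2 + \<tau> * (\<Sum>k<n. (norm (d k))\<^sup>2))"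
        using nT boot by (intro Y_estimate) auto
      ultimately show ?thesis
        by (simp add: e_def)
    qed
    ultimately show ?thesis by blast
  qed
  show ?thesis
    by (rule exI[of _ C\<^sub>X], rule allI, rule main)
qed

end
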